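(* Let $G=(V,E)$ be a simple connected undirected graph with $n\ge 3$ vertices and vertex degrees $d_1,\dots,d_n$, and let $\lambda_1\ge\lambda_2\ge\dots\ge\lambda_n=0$ be the eigenvalues of its normalized Laplacian matrix. Put $b=n+2\sum_{(i,j)\in E}\frac{1}{d_id_j}$ and suppose $b\neq \frac{n^2}{n-1}$. Let $h^{*}=\left\lfloor \frac{n^2}{b}\right\rfloor$. Then $$\lambda_1\ \ge\ Q:=\frac{1}{1+h^{*}}\left(n+\sqrt{\frac{b(h^{*}+1)-n^{2}}{h^{*}}}\right).$$
   Context: The normalized Laplacian of $G$ is $\mathcal{L}(G)=D^{-1/2}(D-A)D^{-1/2}$, where $A$ is the adjacency matrix of $G$ and $D$ is the diagonal matrix of vertex degrees. The sum over $(i,j)\in E$ counts each undirected edge once. *)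

theory Defs
  imports
    "Graph_Theory.Graph_Theory"
    "Jordan_Normal_Form.Char_Poly"
begin

text \<open>
  A simple undirected graph is a \<open>pair_graph\<close>: a finite vertex set with an irreflexive,
  symmetric set of ordered pairs, so an undirected edge occurs as two arcs and the out-degree
  is the number of neighbours. The list \<open>vs\<close> is a numbering of the vertices; vertex number
  \<open>i + 1\<close> of the usual notation is \<open>vs ! i\<close>.
\<close>

definition vertex_numbering :: "'a pair_pre_digraph \<Rightarrow> 'a list \<Rightarrow> bool" where
  "vertex_numbering G vs \<longleftrightarrow> distinct vs \<and> set vs = pverts G"

definition deg :: "'a pair_pre_digraph \<Rightarrow> 'a list \<Rightarrow> nat \<Rightarrow> real" where
  "deg G vs i = real (out_degree (with_proj G) (vs ! i))"

definition adjacency_mat :: "'a pair_pre_digraph \<Rightarrow> 'a list \<Rightarrow> real mat" where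
  "adjacency_mat G vs = mat (length vs) (length vs)
     (\<lambda>(i, j). if (vs ! i, vs ! j) \<in> parcs G then 1 else 0)"

definition degree_mat :: "'a pair_pre_digraph \<Rightarrow> 'a list \<Rightarrow> real mat" where
  "degree_mat G vs = mat (length vs) (length vs) (\<lambda>(i, j). if i = j then deg G vs i else 0)"

text \<open>
  The matrix $D^{-1/2}$, for a graph without isolated vertices (automatic for a connected
  graph with at least two vertices).
\<close>

definition inv_sqrt_degree_mat :: "'a pair_pre_digraph \<Rightarrow> 'a list \<Rightarrow> real mat" where
  "inv_sqrt_degree_mat G vs = mat (length vs) (length vs)
     (\<lambda>(i, j). if i = j then 1 / sqrt (deg G vs i) else 0)"

definition normalized_laplacian :: "'a pair_pre_digraph \<Rightarrow> 'a list \<Rightarrow> real mat" where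
  "normalized_laplacian G vs =
     inv_sqrt_degree_mat G vs * (degree_mat G vs - adjacency_mat G vs) * inv_sqrt_degree_mat G vs"

text \<open>
  All eigenvalues of a matrix, repeated according to algebraic multiplicity, in
  non-increasing order. Such a list is unique, and for a real symmetric matrix it exists.
\<close>

definition eigenvalues_desc :: "real mat \<Rightarrow> real list \<Rightarrow> bool" where
  "eigenvalues_desc M ls \<longleftrightarrow>
     char_poly M = (\<Prod>a\<leftarrow>ls. [:- a, 1:]) \<and> sorted_wrt (\<ge>) ls"

text \<open>The restriction \<open>i < j\<close> makes every undirected edge contribute once.\<close>

definition edge_indices :: "'a pair_pre_digraph \<Rightarrow> 'a list \<Rightarrow> (nat \<times> nat) set" where
  "edge_indices G vs = {(i, j). i < j \<and> j < length vs \<and> (vs ! i, vs ! j) \<in> parcs G}"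

definition b_param :: "'a pair_pre_digraph \<Rightarrow> 'a list \<Rightarrow> real" where
  "b_param G vs = real (length vs)
     + 2 * (\<Sum>(i, j)\<in>edge_indices G vs. 1 / (deg G vs i * deg G vs j))"

end

theory Submission
  imports Defs "Jordan_Normal_Form.Schur_Decomposition"
begin

text \<open>
  The eigenvalues are nonnegative, sum to the trace $n$, and their squares sum to the trace $b$ of
  the squared matrix. Among numbers in $[0,x]$ with sum $n = kx + r$, $0 \le r < x$, the
  sum of squares is largest when $k$ of them equal $x$ and one equals $r$; hence
  $b \le k x^2 + (n - kx)^2$ for $x = \lambda_1$. For $k = h^*$ this is a quadratic inequality
  in $x$ whose larger root is $Q$; for $k < h^*$ already $x > n/h^* \ge Q$; and $k > h^*$
  would give $b \le n x \le n^2/(h^*+1)$, contradicting the choice of $h^*$.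
\<close>

section \<open>Sums of squares of bounded numbers\<close>

text \<open>Greedy packing, by induction on the list: \<open>k\<close> full units \<open>x\<close>
  and a remainder \<open>r\<close> are maintained. A new \<open>t\<close> is either merged into
  \<open>r\<close>, or fills \<open>r\<close> up to \<open>x\<close> and leaves
  \<open>r + t - x\<close>; neither move lowers the sum of squares.\<close>

lemma sum_list_squares_le_extremal:
  fixes x :: real and xs :: "real list"
  assumes "0 < x" and "\<forall>t\<in>set xs. 0 \<le> t \<and> t \<le> x"
  shows "\<exists>(k::nat) r. 0 \<le> r \<and> r < x \<and> sum_list xs = real k * x + r \<and>
    (\<Sum>t\<leftarrow>xs. t\<^sup>2) \<le> real k * x\<^sup>2 + r\<^sup>2"
  using assms(2)
proof (induction xs)
  case Nil
  show ?case using assms(1) by (intro exI[of _ 0]) auto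
next
  case (Cons t xs)
  then obtain k r where r: "0 \<le> r" "r < x" and s: "sum_list xs = real k * x + r"
    and q: "(\<Sum>t\<leftarrow>xs. t\<^sup>2) \<le> real k * x\<^sup>2 + r\<^sup>2" and t: "0 \<le> t" "t \<le> x"
    by auto
  show ?case
  proof (cases "r + t < x")
    case True
    have "0 \<le> r * t" using r t by simp
    then have "r\<^sup>2 + t\<^sup>2 \<le> (r + t)\<^sup>2" by (simp add: power2_sum)
    then show ?thesis using True r t s q
      by (intro exI[of _ k] exI[of _ "r + t"]) simp
  next
    case False
    \<comment> \<open>Twice this product is exactly
      \<open>x\<^sup>2 + (r + t - x)\<^sup>2 - r\<^sup>2 - t\<^sup>2\<close>.\<close>
    have "0 \<le> (x - r) * (x - t)" using r t by simp
    then have "r\<^sup>2 + t\<^sup>2 \<le> x\<^sup>2 + (r + t - x)\<^sup>2"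
      by (simp add: power2_eq_square algebra_simps)
    then show ?thesis using False r t s q
      by (intro exI[of _ "Suc k"] exI[of _ "r + t - x"]) (simp add: algebra_simps)
  qed
qed

text \<open>Multiplying \<open>q\<close> by \<open>h + 1\<close> and completing the square bounds
  \<open>((h + 1) * x - s)\<^sup>2\<close> from below; \<open>low\<close> puts \<open>x\<close> on
  the right of the vertex \<open>s / (h + 1)\<close>, which leaves only the larger root.\<close>

lemma larger_quadratic_root_le:
  fixes x s b h :: real
  assumes h: "1 \<le> h" and low: "s \<le> (h + 1) * x" and q: "b \<le> h * x\<^sup>2 + (s - h * x)\<^sup>2"
  shows "1 / (1 + h) * (s + sqrt ((b * (h + 1) - s\<^sup>2) / h)) \<le> x"
proof -
  have "(h + 1) * b \<le> (h + 1) * (h * x\<^sup>2 + (s - h * x)\<^sup>2)"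
    using h q by (intro mult_left_mono) auto
  also have "\<dots> = h * ((h + 1) * x - s)\<^sup>2 + s\<^sup>2"
    by (simp add: power2_eq_square algebra_simps)
  finally have "(b * (h + 1) - s\<^sup>2) / h \<le> ((h + 1) * x - s)\<^sup>2"
    using h by (simp add: divide_le_eq algebra_simps)
  then have "sqrt ((b * (h + 1) - s\<^sup>2) / h) \<le> (h + 1) * x - s"
    using low by (intro real_le_lsqrt) auto
  then show ?thesis using h by (simp add: field_simps)
qed

text \<open>The numerical core, free of graphs: \<open>xs\<close> will be the spectrum,
  \<open>x\<close> its largest member, \<open>s\<close> the trace and \<open>b\<close> the trace of
  the square.\<close>

lemma max_ge_of_sum_squares:
  fixes x b s :: real and xs :: "real list" and h :: int
  assumes x: "\<forall>t\<in>set xs. 0 \<le> t \<and> t \<le> x"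
    and s: "sum_list xs = s" "0 < s" and b: "(\<Sum>t\<leftarrow>xs. t\<^sup>2) = b"
    and h: "h = \<lfloor>s\<^sup>2 / b\<rfloor>"
  shows "1 / (1 + real_of_int h) *
    (s + sqrt ((b * (real_of_int h + 1) - s\<^sup>2) / real_of_int h)) \<le> x"
proof -
  have "0 < x"
  proof (rule ccontr)
    assume "\<not> 0 < x"
    then have "\<forall>t\<in>set xs. t \<le> 0" using x by force
    then have "sum_list xs \<le> 0" by (rule sum_list_nonpos[OF ballE]) auto
    then show False using s by simp
  qed
  from sum_list_squares_le_extremal[OF this x] obtain k :: nat and r where
    r: "0 \<le> r" "r < x" and sk: "s = real k * x + r" and q: "b \<le> real k * x\<^sup>2 + r\<^sup>2"
    using s b by auto
  have bpos: "0 < b"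
  proof -
    have "0 \<le> b" unfolding b[symmetric] by (intro sum_list_nonneg) auto
    moreover have "b \<noteq> 0"
    proof
      assume "b = 0"
      then have "\<forall>y\<in>set (map (\<lambda>t. t\<^sup>2) xs). y = 0"
        using b by (subst sum_list_nonneg_eq_0_iff[symmetric]) auto
      then have "sum_list xs = 0" by (induction xs) auto
      then show False using s by simp
    qed
    ultimately show ?thesis by simp
  qed
  have hlow: "real_of_int h * b \<le> s\<^sup>2"
    unfolding h pos_le_divide_eq[OF bpos, symmetric] by (rule of_int_floor_le)
  have hup: "s\<^sup>2 < (real_of_int h + 1) * b"
    unfolding h pos_divide_less_eq[OF bpos, symmetric] by linarith
  have bnx: "b \<le> s * x"
  proof -
    have "r * r \<le> r * x" using r by (intro mult_left_mono) auto
    then show ?thesis using q sk by (simp add: power2_eq_square algebra_simps)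
  qed
  \<comment> \<open>Otherwise \<open>(h + 1) * x \<le> s\<close>, and \<open>bnx\<close> yields
    \<open>(h + 1) * b \<le> s\<^sup>2\<close>, against \<open>hup\<close>.\<close>
  have kh: "int k \<le> h"
  proof (rule ccontr)
    assume "\<not> int k \<le> h"
    then have "real_of_int h + 1 \<le> real k" by linarith
    then have "(real_of_int h + 1) * x \<le> real k * x"
      using \<open>0 < x\<close> by (intro mult_right_mono) auto
    then have "(real_of_int h + 1) * x \<le> s" using sk r by linarith
    then have "s * ((real_of_int h + 1) * x) \<le> s * s" using s by (intro mult_left_mono) auto
    moreover have "0 \<le> real_of_int h + 1" using hup bpos
      by (smt (verit) mult_nonpos_nonneg zero_le_power2)
    then have "(real_of_int h + 1) * b \<le> (real_of_int h + 1) * (s * x)"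
      using bnx by (intro mult_left_mono) auto
    ultimately show False using hup by (simp add: power2_eq_square algebra_simps)
  qed
  \<comment> \<open>This allows division by \<open>h\<close>. If it failed, no full unit would fit,
    so \<open>s = r\<close> and \<open>b \<le> s\<^sup>2\<close>, which already forces the floor to
    be at least 1.\<close>
  have "1 \<le> h"
  proof (rule ccontr)
    assume "\<not> 1 \<le> h"
    then have "k = 0" using kh by simp
    then have "b \<le> s\<^sup>2" using q sk by simp
    then have "1 \<le> s\<^sup>2 / b" using bpos by simp
    then show False using h \<open>\<not> 1 \<le> h\<close> by linarith
  qed
  then have h1: "1 \<le> real_of_int h" by simp
  show ?thesis
  proof (cases "int k = h")
    case True
    then have k: "real k = real_of_int h" by (metis of_int_of_nat_eq)
    show ?thesis
    proof (rule larger_quadratic_root_le[OF h1])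
      show "s \<le> (real_of_int h + 1) * x" using sk k r by (simp add: algebra_simps)
      show "b \<le> real_of_int h * x\<^sup>2 + (s - real_of_int h * x)\<^sup>2" using q sk k by simp
    qed
  next
    case False
    then have "real k + 1 \<le> real_of_int h" using kh by linarith
    then have "s \<le> real_of_int h * x"
      using sk r \<open>0 < x\<close> mult_right_mono[of "real k + 1" "real_of_int h" x]
      by (simp add: algebra_simps)
    then have "s / real_of_int h \<le> x" using h1 by (simp add: field_simps)
    \<comment> \<open>The root criterion is applied at the point \<open>s / h\<close>: there the
      remainder term vanishes and the condition on \<open>b\<close> becomes
      \<open>b \<le> s\<^sup>2 / h\<close>, which is \<open>hlow\<close>.\<close>
    moreover have "1 / (1 + real_of_int h) *
        (s + sqrt ((b * (real_of_int h + 1) - s\<^sup>2) / real_of_int h)) \<le> s / real_of_int h"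
    proof (rule larger_quadratic_root_le[OF h1])
      show "s \<le> (real_of_int h + 1) * (s / real_of_int h)" using h1 s by (simp add: field_simps)
      have "b \<le> s\<^sup>2 / real_of_int h" using h1 hlow by (simp add: field_simps)
      then show "b \<le> real_of_int h * (s / real_of_int h)\<^sup>2
          + (s - real_of_int h * (s / real_of_int h))\<^sup>2"
        using h1 by (simp add: power2_eq_square)
    qed
    ultimately show ?thesis by linarith
  qed
qed

section \<open>Eigenvalue sums\<close>

definition mat_trace :: "'a :: comm_monoid_add mat \<Rightarrow> 'a" where
  "mat_trace A = (\<Sum>i<dim_row A. A $$ (i, i))"

lemma index_mult_mat_sum:
  assumes "A \<in> carrier_mat n m" "B \<in> carrier_mat m p" "i < n" "j < p"
  shows "(A * B) $$ (i, j) = (\<Sum>l<m. A $$ (i, l) * B $$ (l, j))"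
  using assms by (simp add: scalar_prod_def atLeast0LessThan)

lemma mat_trace_mult:
  assumes "A \<in> carrier_mat n m" "B \<in> carrier_mat m n"
  shows "mat_trace (A * B) = (\<Sum>i<n. \<Sum>j<m. A $$ (i, j) * B $$ (j, i))"
proof -
  have "dim_row (A * B) = n" using assms by simp
  then show ?thesis
    unfolding mat_trace_def by (auto intro!: sum.cong index_mult_mat_sum[OF assms])
qed

lemma mat_trace_mult_commute:
  fixes A B :: "'a :: comm_semiring_0 mat"
  assumes "A \<in> carrier_mat n m" "B \<in> carrier_mat m n"
  shows "mat_trace (A * B) = mat_trace (B * A)"
  unfolding mat_trace_mult[OF assms] mat_trace_mult[OF assms(2,1)]
  by (subst sum.swap) (simp add: mult.commute)

lemma mat_trace_similar:
  fixes A B :: "'a :: comm_ring_1 mat"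
  assumes "similar_mat A B"
  shows "mat_trace A = mat_trace B"
proof -
  from similar_matD[OF assms] obtain n P Q where
    c: "A \<in> carrier_mat n n" "B \<in> carrier_mat n n" "P \<in> carrier_mat n n" "Q \<in> carrier_mat n n"
    and QP: "Q * P = 1\<^sub>m n" and A: "A = P * B * Q"
    by auto
  have "mat_trace A = mat_trace (Q * (P * B))"
    unfolding A using c by (intro mat_trace_mult_commute) auto
  also have "Q * (P * B) = Q * P * B" using c by simp
  finally show ?thesis using c QP by simp
qed

text \<open>Since the characteristic polynomial splits, Schur decomposition gives a similar upper
  triangular matrix with diagonal \<open>es\<close>; both traces are invariant under
  similarity.\<close>

lemma char_poly_linear_factors_sums:
  fixes A :: "real mat"
  assumes A: "A \<in> carrier_mat n n" and cp: "char_poly A = (\<Prod>a\<leftarrow>es. [:- a, 1:])"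
  shows "sum_list es = mat_trace A" and "(\<Sum>a\<leftarrow>es. a\<^sup>2) = mat_trace (A * A)"
proof -
  obtain B P Q where "schur_decomposition A es = (B, P, Q)" by (metis prod_cases3)
  from schur_decomposition[OF A cp this]
  have wit: "similar_mat_wit A B P Q" and ut: "upper_triangular B" and es: "diag_mat B = es"
    by auto
  have B: "B \<in> carrier_mat n n" using similar_mat_witD2[OF A wit] by simp
  have "sum_list es = mat_trace B"
    unfolding es[symmetric] mat_trace_def diag_mat_def
    by (simp add: sum_list_sum_nth atLeast0LessThan)
  also have "\<dots> = mat_trace A"
    using mat_trace_similar[of A B] wit unfolding similar_mat_def by metis
  finally show "sum_list es = mat_trace A" .
  have "mat_trace (B * B) = (\<Sum>i<n. \<Sum>j<n. if j = i then (B $$ (i, i))\<^sup>2 else 0)"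
    unfolding mat_trace_mult[OF B B]
  proof (intro sum.cong refl)
    fix i j assume "i \<in> {..<n}" "j \<in> {..<n}"
    \<comment> \<open>Off the diagonal, one of the two factors lies below it and is zero.\<close>
    then show "B $$ (i, j) * B $$ (j, i) = (if j = i then (B $$ (i, i))\<^sup>2 else 0)"
      using B upper_triangularD[OF ut, of i j] upper_triangularD[OF ut, of j i]
      by (cases i j rule: linorder_cases) (auto simp: power2_eq_square)
  qed
  also have "\<dots> = (\<Sum>a\<leftarrow>es. a\<^sup>2)"
    using B unfolding es[symmetric] diag_mat_def
    by (simp add: sum_list_sum_nth atLeast0LessThan)
  finally have "(\<Sum>a\<leftarrow>es. a\<^sup>2) = mat_trace (B * B)" by simp
  also have "\<dots> = mat_trace (A * A)"
  proof -
    have "similar_mat (A ^\<^sub>m 2) (B ^\<^sub>m 2)"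
      using similar_mat_wit_pow[OF wit] by (auto simp: similar_mat_def)
    then have "mat_trace (A ^\<^sub>m 2) = mat_trace (B ^\<^sub>m 2)" by (rule mat_trace_similar)
    then show ?thesis using A B by (simp add: numeral_2_eq_2)
  qed
  finally show "(\<Sum>a\<leftarrow>es. a\<^sup>2) = mat_trace (A * A)" .
qed

section \<open>The normalized Laplacian\<close>

text \<open>A second vertex is reachable from \<open>v\<close>, because symmetry of the arcs turns
  connectedness into strong connectedness; the first arc of such a walk leaves
  \<open>v\<close>.\<close>

lemma (in pair_graph) connected_out_degree_pos:
  assumes con: "connected G" and card: "2 \<le> card (pverts G)" and v: "v \<in> pverts G"
  shows "0 < out_degree G v"
proof -
  have "pverts G \<noteq> {v}" using card by auto
  then obtain u where u: "u \<in> pverts G" "u \<noteq> v" using v by blast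
  have "strongly_connected G"
    using con symmetric_connected_imp_strongly_connected pair_sym_arcs by blast
  then have "v \<rightarrow>\<^sup>*\<^bsub>G\<^esub> u" using u v by auto
  then obtain w where "(v, w) \<in> parcs G"
    using u by (cases rule: converse_reachable_cases) auto
  then have "(v, w) \<in> out_arcs G v" by simp
  then have "out_arcs G v \<noteq> {}" by blast
  then show ?thesis
    unfolding out_degree_def using finite_out_arcs[of v] by (simp add: card_gt_0_iff)
qed

text \<open>Connectedness enters the matrix computations only through positive degrees: a vertex of
  degree 0 would get the diagonal entry 0 instead of 1, as \<open>1 / sqrt 0 = 0\<close>.\<close>

locale numbered_graph = pair_graph G for G :: "'a pair_pre_digraph" +
  fixes vs :: "'a list"
  assumes numbering: "vertex_numbering G vs"
    and deg_pos: "i < length vs \<Longrightarrow> 0 < deg G vs i"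
begin

abbreviation "n \<equiv> length vs"
abbreviation "d \<equiv> deg G vs"
abbreviation "L \<equiv> normalized_laplacian G vs"
abbreviation adj :: "nat \<Rightarrow> nat \<Rightarrow> bool" where "adj i j \<equiv> (vs ! i, vs ! j) \<in> parcs G"

lemma adj_irrefl: "\<not> adj i i"
  using pair_no_loops by force

lemma adj_sym: "adj i j \<longleftrightarrow> adj j i"
  using pair_sym_arcs by (auto simp: symmetric_def dest: symD)

text \<open>Passes from arcs to neighbour indices, over which the matrix sums run; distinctness of
  \<open>vs\<close> makes the correspondence injective.\<close>

lemma deg_eq_card: "d i = real (card {j. j < n \<and> adj i j})"
proof -
  have "bij_betw (\<lambda>j. (vs ! i, vs ! j)) {j. j < n \<and> adj i j} (out_arcs G (vs ! i))"
  proof (rule bij_betwI')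
    fix e assume e: "e \<in> out_arcs G (vs ! i)"
    then have "snd e \<in> set vs"
      using numbering arc_snd_in_verts by (auto simp: vertex_numbering_def)
    then obtain j where "j < n" "vs ! j = snd e" by (auto simp: in_set_conv_nth)
    with e show "\<exists>j\<in>{j. j < n \<and> adj i j}. e = (vs ! i, vs ! j)" by (cases e) auto
  qed (use numbering in \<open>auto simp: vertex_numbering_def nth_eq_iff_index_eq\<close>)
  then show ?thesis by (simp add: deg_def out_degree_def bij_betw_same_card)
qed

lemma laplacian_carrier: "L \<in> carrier_mat n n"
  by (intro carrier_matI) (simp_all add: normalized_laplacian_def inv_sqrt_degree_mat_def)

lemma laplacian_entry:
  assumes "i < n" "j < n"
  shows "L $$ (i, j) =
    (if i = j then 1 else if adj i j then - 1 / (sqrt (d i) * sqrt (d j)) else 0)"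
proof -
  let ?S = "inv_sqrt_degree_mat G vs" and ?M = "degree_mat G vs - adjacency_mat G vs"
  have M: "?M \<in> carrier_mat n n" by (simp add: adjacency_mat_def minus_carrier_mat)
  have S: "?S \<in> carrier_mat n n" by (simp add: inv_sqrt_degree_mat_def)
  have 1: "(?S * ?M) $$ (i, k) = ?M $$ (i, k) / sqrt (d i)" if "k < n" for k
  proof -
    \<comment> \<open>A diagonal factor on the left scales row \<open>i\<close>; the one on the
      right scales column \<open>j\<close> below.\<close>
    have "(?S * ?M) $$ (i, k) = (\<Sum>l<n. ?S $$ (i, l) * ?M $$ (l, k))"
      by (rule index_mult_mat_sum[OF S M assms(1) that])
    also have "\<dots> = (\<Sum>l<n. if l = i then ?M $$ (i, k) / sqrt (d i) else 0)"
      using assms by (intro sum.cong refl) (auto simp: inv_sqrt_degree_mat_def)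
    finally show ?thesis using assms by simp
  qed
  have "L $$ (i, j) = (\<Sum>k<n. (?S * ?M) $$ (i, k) * ?S $$ (k, j))"
    unfolding normalized_laplacian_def
    by (rule index_mult_mat_sum[OF mult_carrier_mat[OF S M] S assms])
  also have "\<dots> = (\<Sum>k<n. if k = j then ?M $$ (i, k) / sqrt (d i) / sqrt (d j) else 0)"
    using assms by (intro sum.cong refl) (subst 1, auto simp: inv_sqrt_degree_mat_def)
  also have "\<dots> = ?M $$ (i, j) / (sqrt (d i) * sqrt (d j))" using assms by simp
  also have "?M $$ (i, j) = (if i = j then d i else if adj i j then - 1 else 0)"
    using assms adj_irrefl by (auto simp: degree_mat_def adjacency_mat_def)
  finally show ?thesis using deg_pos[OF assms(1)] by auto
qed

lemma laplacian_trace: "mat_trace L = real n"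
  using laplacian_carrier by (simp add: mat_trace_def laplacian_entry)

text \<open>By symmetry the trace is the sum of all squared entries: the diagonal gives
  \<open>n\<close>, and each edge gives \<open>1 / (d i * d j)\<close> twice, once per
  orientation.\<close>

lemma laplacian_square_trace: "mat_trace (L * L) = b_param G vs"
proof -
  define f where "f i j = (if adj i j then 1 / (d i * d j) else 0)" for i j
  have f_sym: "f i j = f j i" for i j using adj_sym[of i j] by (simp add: f_def mult.commute)
  have f_refl: "f i i = 0" for i using adj_irrefl by (simp add: f_def)
  have half: "(\<Sum>i<n. \<Sum>j<n. if i < j then f i j else 0)
      = (\<Sum>(i, j)\<in>edge_indices G vs. 1 / (d i * d j))"
    unfolding sum.cartesian_product
    by (rule sum.mono_neutral_cong_right) (auto simp: edge_indices_def f_def split: if_splits)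
  have "mat_trace (L * L) = (\<Sum>i<n. \<Sum>j<n. (if j = i then 1 else 0) + f i j)"
    unfolding mat_trace_mult[OF laplacian_carrier laplacian_carrier]
  proof (intro sum.cong refl)
    fix i j assume "i \<in> {..<n}" "j \<in> {..<n}"
    then have ij: "i < n" "j < n" by auto
    have "sqrt (d i) * sqrt (d j) * (sqrt (d j) * sqrt (d i))
        = (sqrt (d i) * sqrt (d i)) * (sqrt (d j) * sqrt (d j))"
      by (simp only: ac_simps)
    also have "\<dots> = d i * d j" using deg_pos ij by (simp add: less_imp_le)
    finally have "sqrt (d i) * sqrt (d j) * (sqrt (d j) * sqrt (d i)) = d i * d j" .
    then show "L $$ (i, j) * L $$ (j, i) = (if j = i then 1 else 0) + f i j"
      using ij adj_sym[of i j] adj_irrefl by (auto simp: laplacian_entry f_def)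
  qed
  also have "\<dots> = real n + (\<Sum>i<n. \<Sum>j<n. f i j)" by (simp add: sum.distrib)
  \<comment> \<open>The sum is split at the diagonal, with the arguments of \<open>f\<close>
    exchanged in the lower half so that \<open>sum.swap\<close> maps it onto the upper one.\<close>
  also have "(\<Sum>i<n. \<Sum>j<n. f i j)
      = (\<Sum>i<n. \<Sum>j<n. (if i < j then f i j else 0) + (if j < i then f j i else 0))"
    by (intro sum.cong refl) (auto simp: f_refl f_sym not_less_iff_gr_or_eq)
  also have "\<dots> = (\<Sum>i<n. \<Sum>j<n. if i < j then f i j else 0)
      + (\<Sum>i<n. \<Sum>j<n. if j < i then f j i else 0)"
    by (simp add: sum.distrib)
  also have "(\<Sum>i<n. \<Sum>j<n. if j < i then f j i else 0)
      = (\<Sum>i<n. \<Sum>j<n. if i < j then f i j else 0)"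
    by (rule sum.swap)
  finally show ?thesis by (simp add: half b_param_def)
qed

text \<open>
  Put $w_i = v_i / \sqrt{d_i}$ for an eigenvector $v$. Then $(1 - k) w_i$ is the mean of $w$ over
  the neighbours of $i$, so $|1 - k| \le 1$ follows by choosing $i$ with $|w_i|$ maximal.
\<close>

lemma laplacian_eigenvalue_nonneg:
  assumes "eigenvalue L k"
  shows "0 \<le> k"
proof -
  from assms obtain v where v: "v \<in> carrier_vec n" "v \<noteq> 0\<^sub>v n" and Lv: "L *\<^sub>v v = k \<cdot>\<^sub>v v"
    using laplacian_carrier by (auto simp: eigenvalue_def eigenvector_def)
  define w where "w i = v $ i / sqrt (d i)" for i
  have vw: "v $ i = sqrt (d i) * w i" if "i < n" for i
    using deg_pos[OF that] by (simp add: w_def)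
  \<comment> \<open>Row \<open>i\<close> of the eigenvector equation, rescaled by
    \<open>sqrt (d i)\<close>.\<close>
  have mean: "(1 - k) * d i * w i = (\<Sum>j | j < n \<and> adj i j. w j)" if i: "i < n" for i
  proof -
    have "k * v $ i = (L *\<^sub>v v) $ i" using Lv i v by simp
    also have "\<dots> = (\<Sum>j<n. L $$ (i, j) * v $ j)"
      using laplacian_carrier i v by (simp add: scalar_prod_def atLeast0LessThan)
    also have "\<dots> = (\<Sum>j<n. (if j = i then v $ i else 0) - (if adj i j then w j / sqrt (d i) else 0))"
      using i adj_irrefl by (intro sum.cong refl) (auto simp: laplacian_entry w_def)
    also have "\<dots> = v $ i - (\<Sum>j<n. if adj i j then w j / sqrt (d i) else 0)"
      using i by (simp add: sum_subtractf)
    also have "(\<Sum>j<n. if adj i j then w j / sqrt (d i) else 0)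
        = (\<Sum>j | j < n \<and> adj i j. w j) / sqrt (d i)"
      unfolding sum_divide_distrib by (rule sum.mono_neutral_cong_right) auto
    finally have "(\<Sum>j | j < n \<and> adj i j. w j) / sqrt (d i) = (1 - k) * v $ i"
      by (simp add: algebra_simps)
    then have "(\<Sum>j | j < n \<and> adj i j. w j) = (1 - k) * (sqrt (d i) * sqrt (d i)) * w i"
      using deg_pos[OF i] vw[OF i] by (simp add: divide_eq_eq)
    then show ?thesis using deg_pos[OF i] by simp
  qed
  obtain m where m: "m < n" "v $ m \<noteq> 0"
    using v by (metis carrier_vecD eq_vecI index_zero_vec)
  then have "{..<n} \<noteq> {}" by auto
  then obtain i where i: "i < n" and max: "\<And>j. j < n \<Longrightarrow> \<bar>w j\<bar> \<le> \<bar>w i\<bar>"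
    using obtains_MAX[of "{..<n}" "\<lambda>j. \<bar>w j\<bar>"]
    by (metis Max_ge finite_imageI finite_lessThan imageI lessThan_iff)
  \<comment> \<open>A nonzero coordinate of \<open>v\<close> makes the maximum positive, so it can
    be cancelled at the end.\<close>
  have "0 < \<bar>w m\<bar>" using m deg_pos[OF m(1)] by (simp add: w_def)
  then have wi: "0 < \<bar>w i\<bar>" using max[OF m(1)] by simp
  have "\<bar>1 - k\<bar> * (d i * \<bar>w i\<bar>) = \<bar>\<Sum>j | j < n \<and> adj i j. w j\<bar>"
    using mean[OF i] deg_pos[OF i] by (simp add: abs_mult flip: mean[OF i])
  also have "\<dots> \<le> (\<Sum>j | j < n \<and> adj i j. \<bar>w j\<bar>)" by (rule sum_abs)
  also have "\<dots> \<le> (\<Sum>j | j < n \<and> adj i j. \<bar>w i\<bar>)" by (rule sum_mono) (use max in auto)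
  also have "\<dots> = 1 * (d i * \<bar>w i\<bar>)" by (simp add: deg_eq_card)
  finally have "\<bar>1 - k\<bar> \<le> 1" using wi deg_pos[OF i] by (simp only: mult_le_cancel_right_pos mult_pos_pos)
  then show ?thesis by simp
qed

end

theorem mainTheorem1:
  fixes G :: "'a pair_pre_digraph"
    and vs :: "'a list"
    and n :: nat
    and lambda :: "real list"
    and b :: real
    and h :: int
  assumes "pair_graph G"
    and "Digraph_Component.connected (with_proj G)"
    and "n = card (pverts G)"
    and "n \<ge> 3"
    and "vertex_numbering G vs"
    and "eigenvalues_desc (normalized_laplacian G vs) lambda"
    and "b = b_param G vs"
    and "b \<noteq> (real n)\<^sup>2 / (real n - 1)"
    and "h = \<lfloor>(real n)\<^sup>2 / b\<rfloor>"
  shows "lambda ! 0 \<ge>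
    1 / (1 + real_of_int h) *
      (real n + sqrt ((b * (real_of_int h + 1) - (real n)\<^sup>2) / real_of_int h))"
proof -
  interpret pair_graph G by fact
  have n: "n = length vs" and vs: "set vs = pverts G"
    using assms(3,5) distinct_card[of vs] by (auto simp: vertex_numbering_def)
  interpret numbered_graph G vs
  proof
    show "vertex_numbering G vs" by fact
    fix i assume "i < length vs"
    then have "vs ! i \<in> pverts G" using vs nth_mem by blast
    then show "0 < deg G vs i"
      using connected_out_degree_pos[OF assms(2)] assms(3,4) by (simp add: deg_def)
  qed
  let ?L = "normalized_laplacian G vs"
  have cp: "char_poly ?L = (\<Prod>a\<leftarrow>lambda. [:- a, 1:])" and desc: "sorted_wrt (\<ge>) lambda"
    using assms(6) by (auto simp: eigenvalues_desc_def)
  \<comment> \<open>Members of \<open>lambda\<close> are roots of the characteristic polynomial,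
    hence eigenvalues; the ordering puts the largest at index 0.\<close>
  have "0 \<le> t \<and> t \<le> lambda ! 0" if t: "t \<in> set lambda" for t
  proof
    have "poly (char_poly ?L) t = 0"
      unfolding cp using t by (auto simp: poly_prod_list prod_list_zero_iff)
    then show "0 \<le> t"
      using laplacian_eigenvalue_nonneg eigenvalue_root_char_poly[OF laplacian_carrier] by blast
    show "t \<le> lambda ! 0" using t desc by (cases lambda) auto
  qed
  then show ?thesis
    using char_poly_linear_factors_sums[OF laplacian_carrier cp] assms(4,7,9)
    by (intro max_ge_of_sum_squares[of lambda])
      (auto simp: laplacian_trace laplacian_square_trace n)
qed

end
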